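(* For every $p>1$ one has $\mathfrak{C}_{2}\subset\mathfrak{H}_{p}$, and there exists a constant $C_{p}>0$ such that $$\|f\|_{\mathfrak{H}_{p}}\le C_{p}\|f\|_{2}$$ for every $f\in\mathfrak{C}_{2}$.
   Context: $\mathcal{R}=\{z\in\mathbb{C}:\Re z>0\}$, and $\mathcal{H}(\mathcal{R})$ is the space of analytic functions on $\mathcal{R}$. $\|\cdot\|_{2}$ is the $L^{2}(0,1)$ norm. $\mathfrak{C}_{2}$ is the set of functions $f(x)=\int_{0}^{\infty}e^{-xt}\,d\sigma(t)$ with $\sigma$ a positive Borel-regular measure on $[0,\infty)$ such that $f(x)<\infty$ for all $x>0$ and $\|f\|_{2}<\infty$; such $f$ are regarded as analytic functions on $\mathcal{R}$ through the same formula. $H=\{\phi\in H^{2}(\mathcal{R}):\overline{\phi(z)}=\phi(\bar z)\}$ is the real subspace of the Hardy space $H^2(\mathcal R)$, with norm $\|\phi\|^{2}=\sup_{x>0}\frac{1}{2\pi}\int_{\mathbb{R}}|\phi(x+iy)|^{2}dy$. For $p\ge 1$ and $f\in\mathcal{H}(\mathcal{R})$ let $$(\mathcal{F}_{p}[f])(z)=\frac{f(z^{1/p})}{z^{\frac{p-1}{2p}}(z^{1/p}+1)},\quad z\in\mathcal{R},$$ with principal branches of powers. Then $\mathfrak{H}_{p}=\{f\in\mathcal{H}(\mathcal{R}):\mathcal{F}_{p}[f]\in H\}$ with norm $\|f\|_{\mathfrak{H}_{p}}=\|\mathcal{F}_{p}[f]\|$. *)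

theory Defs
  imports "HOL-Complex_Analysis.Complex_Analysis"
begin

definition right_half_plane :: "complex set" where
  "right_half_plane = {z. Re z > 0}"

text \<open>
  Functions on the right half-plane are represented by total functions on the complex numbers.
  All notions below depend only on their values on the half-plane; values elsewhere are arbitrary.
\<close>

definition hardy_sqnorm :: "(complex \<Rightarrow> complex) \<Rightarrow> ennreal" where
  "hardy_sqnorm \<phi> =
     (SUP x\<in>{0<..}. ennreal (1 / (2 * pi)) *
        (\<integral>\<^sup>+y. ennreal ((cmod (\<phi> (Complex x y)))\<^sup>2) \<partial>lborel))"

definition hardy_norm :: "(complex \<Rightarrow> complex) \<Rightarrow> real" where
  "hardy_norm \<phi> = sqrt (enn2real (hardy_sqnorm \<phi>))"

definition hardy_space :: "(complex \<Rightarrow> complex) set" where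
  "hardy_space = {\<phi>. \<phi> holomorphic_on right_half_plane \<and> hardy_sqnorm \<phi> < \<infinity>}"

definition real_hardy_space :: "(complex \<Rightarrow> complex) set" where
  "real_hardy_space =
     {\<phi> \<in> hardy_space. \<forall>z\<in>right_half_plane. cnj (\<phi> z) = \<phi> (cnj z)}"

definition F_transform :: "real \<Rightarrow> (complex \<Rightarrow> complex) \<Rightarrow> complex \<Rightarrow> complex" where
  "F_transform p f z =
     f (z powr of_real (1 / p)) /
       (z powr of_real ((p - 1) / (2 * p)) * (z powr of_real (1 / p) + 1))"

definition frak_H :: "real \<Rightarrow> (complex \<Rightarrow> complex) set" where
  "frak_H p = {f. f holomorphic_on right_half_plane \<and> F_transform p f \<in> real_hardy_space}"

definition frak_H_norm :: "real \<Rightarrow> (complex \<Rightarrow> complex) \<Rightarrow> real" where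
  "frak_H_norm p f = hardy_norm (F_transform p f)"

text \<open>The squared \<open>L\<^sup>2(0,1)\<close> norm of the restriction of \<open>f\<close> to the real interval.\<close>

definition L2_sqnorm :: "(complex \<Rightarrow> complex) \<Rightarrow> ennreal" where
  "L2_sqnorm f = (\<integral>\<^sup>+x\<in>{0<..<1}. ennreal ((cmod (f (complex_of_real x)))\<^sup>2) \<partial>lborel)"

definition L2_norm :: "(complex \<Rightarrow> complex) \<Rightarrow> real" where
  "L2_norm f = sqrt (enn2real (L2_sqnorm f))"

text \<open>
  The representing measure lives on the Borel sigma-algebra of the half-line, where Borel
  regularity (every set is contained in a Borel set of the same outer measure) is no further
  restriction. Finiteness of the nonnegative integral for all \<open>x > 0\<close> makes the Bochner integral
  defining \<open>f z\<close> converge absolutely on the whole half-plane.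
\<close>

definition frak_C2 :: "(complex \<Rightarrow> complex) set" where
  "frak_C2 =
     {f. (\<exists>\<sigma>::real measure.
            sets \<sigma> = sets (restrict_space borel {0..}) \<and>
            (\<forall>x>0. (\<integral>\<^sup>+t. ennreal (exp (- (x * t))) \<partial>\<sigma>) < \<infinity>) \<and>
            (\<forall>z\<in>right_half_plane. f z = (\<integral>t. exp (- (z * complex_of_real t)) \<partial>\<sigma>))) \<and>
         L2_sqnorm f < \<infinity>}"

end

theory Submission imports Defs begin

text \<open>
  The Hardy norm is controlled by a single pointwise majorant that serves all vertical lines at
  once.

  A Laplace transform \<open>f\<close> of a positive measure satisfies \<open>|f(w)| \<le> f(Re w)\<close> and decreases on
  \<open>(0, \<infinity>)\<close> (\<open>norm_laplace_le\<close>, \<open>norm_laplace_antimono\<close>). For \<open>z\<close> in the half-plane,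
  \<open>w = z powr (1/p)\<close> lies in the sector \<open>|arg w| < \<pi>/(2p)\<close>, and because \<open>p > 1\<close> the number
  \<open>c = cos(\<pi>/(2p))\<close> is positive, so that \<open>Re w \<ge> c |w|\<close> (\<open>Re_powr_root_ge\<close>). Together with
  \<open>|w + 1|\<^sup>2 \<ge> |w|\<^sup>2 + 1\<close> this bounds the square of the transformed function at \<open>z\<close> by
  \<open>G(|z|)\<close>, where

  \<open>G(r) = f(c r powr (1/p))\<^sup>2 / (r powr ((p-1)/p) (r powr (2/p) + 1))\<close>.

  Now \<open>G\<close> is decreasing and \<open>|z| \<ge> |Im z|\<close>, so on every vertical line the square is at most
  \<open>G(|Im z|)\<close>, a function of the height alone (\<open>F_transform_le_line_majorant\<close>).

  The substitution \<open>r = u powr p\<close> turns the integral of \<open>G\<close> into \<open>p\<close> times that of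
  \<open>f(c u)\<^sup>2 / (u\<^sup>2 + 1)\<close> over \<open>(0, \<infinity>)\<close>. The part \<open>c u < 1\<close> gives at most \<open>1/c\<close> times the squared
  \<open>L\<^sup>2(0,1)\<close> norm. On the part \<open>c u \<ge> 1\<close> monotonicity gives \<open>f(c u) \<le> f(1)\<close>, and \<open>f(1)\<^sup>2\<close>, being
  the least value of \<open>f\<^sup>2\<close> on \<open>(0,1]\<close>, is again at most that squared norm, while \<open>1/(u\<^sup>2 + 1)\<close> has
  integral \<open>\<pi>/2\<close> (\<open>antimono_weighted_integral_bound\<close>). Hence the constant
  \<open>C\<^sup>2 = p/\<pi> (1/c + \<pi>/2)\<close>.
\<close>

section \<open>Laplace transforms of positive measures\<close>

text \<open>
  Mean value inequality on a disc: it supplies the dominating function when a Laplace integral is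
  differentiated under the integral sign.
\<close>
lemma complex_exp_difference_bound:
  fixes z w :: complex and t d :: real
  assumes "t \<ge> 0" and "cmod (w - z) \<le> d"
  shows "cmod (exp (- (w * of_real t)) - exp (- (z * of_real t)))
           \<le> t * exp (- ((Re z - d) * t)) * cmod (w - z)"
proof (rule field_differentiable_bound[of "cball z d"])
  show "((\<lambda>u. exp (- (u * of_real t))) has_field_derivative
          exp (- (u * of_real t)) * (- of_real t)) (at u within cball z d)" for u :: complex
    by (auto intro!: derivative_eq_intros)
next
  fix u assume u: "u \<in> cball z d"
  have "\<bar>Re u - Re z\<bar> \<le> cmod (u - z)"
    using abs_Re_le_cmod[of "u - z"] by simp
  with u have "Re z - d \<le> Re u"
    by (auto simp: dist_norm norm_minus_commute)
  with assms(1) have "(Re z - d) * t \<le> Re u * t"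
    by (rule mult_right_mono[rotated])
  then show "cmod (exp (- (u * of_real t)) * (- of_real t)) \<le> t * exp (- ((Re z - d) * t))"
    using assms(1) by (simp add: norm_mult mult.commute mult_left_mono)
qed (use assms in \<open>auto simp: dist_norm norm_minus_commute intro: order_trans[OF norm_ge_zero]\<close>)

locale laplace_measure =
  fixes \<sigma> :: "real measure"
  assumes sets_eq: "sets \<sigma> = sets (restrict_space borel {0..})"
    and laplace_finite: "\<And>x. x > 0 \<Longrightarrow> (\<integral>\<^sup>+t. ennreal (exp (- (x * t))) \<partial>\<sigma>) < \<infinity>"
begin

definition laplace :: "complex \<Rightarrow> complex" where
  "laplace z = (\<integral>t. exp (- (z * complex_of_real t)) \<partial>\<sigma>)"

lemma space_nonneg: "t \<in> space \<sigma> \<Longrightarrow> 0 \<le> t"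
  using sets_eq_imp_space_eq[OF sets_eq] by (simp add: space_restrict_space)

lemma borel_measurable_restrict:
  "g \<in> borel_measurable borel \<Longrightarrow> g \<in> borel_measurable \<sigma>"
  by (subst measurable_cong_sets[OF sets_eq refl]) (rule measurable_restrict_space1)

lemma integrable_exp:
  assumes "x > 0"
  shows "integrable \<sigma> (\<lambda>t. exp (- (x * t)))"
proof (rule integrableI_bounded)
  show "(\<lambda>t. exp (- (x * t))) \<in> borel_measurable \<sigma>"
    by (rule borel_measurable_restrict) measurable
qed (use laplace_finite[OF assms] in simp)

lemma measurable_kernel: "(\<lambda>t. exp (- (z * complex_of_real t))) \<in> borel_measurable \<sigma>"
  by (rule borel_measurable_restrict) measurable

lemma integrable_kernel:
  assumes "Re z > 0"
  shows "integrable \<sigma> (\<lambda>t. exp (- (z * complex_of_real t)))"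
  by (rule Bochner_Integration.integrable_bound[OF integrable_exp[OF assms] measurable_kernel])
     simp

lemma laplace_of_real: "laplace (of_real x) = of_real (\<integral>t. exp (- (x * t)) \<partial>\<sigma>)"
proof -
  have "exp (- (complex_of_real x * of_real t)) = of_real (exp (- (x * t)))" for t
    by (simp add: exp_of_real[symmetric])
  then show ?thesis
    unfolding laplace_def by simp
qed

lemma norm_laplace_of_real: "cmod (laplace (of_real x)) = (\<integral>t. exp (- (x * t)) \<partial>\<sigma>)"
  unfolding laplace_of_real by simp

lemma norm_laplace_le: "cmod (laplace z) \<le> cmod (laplace (of_real (Re z)))"
proof -
  have "cmod (laplace z) \<le> (\<integral>t. cmod (exp (- (z * complex_of_real t))) \<partial>\<sigma>)"
    unfolding laplace_def by (rule integral_norm_bound)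
  then show ?thesis
    by (simp add: norm_laplace_of_real)
qed

lemma norm_laplace_antimono:
  assumes "0 < x" "x \<le> y"
  shows "cmod (laplace (of_real y)) \<le> cmod (laplace (of_real x))"
  unfolding norm_laplace_of_real using assms
  by (intro integral_mono integrable_exp) (auto intro!: mult_right_mono space_nonneg)

lemma cnj_laplace: "cnj (laplace z) = laplace (cnj z)"
  unfolding laplace_def by (simp add: exp_cnj flip: Bochner_Integration.integral_cnj)

text \<open>
  Dominated convergence of the difference quotients. Within distance \<open>d = Re z / 2\<close> of \<open>z\<close> the
  quotients of the kernel are at most \<open>t exp(-d t)\<close>; half of the exponential absorbs the factor \<open>t\<close>,
  and the other half is integrable because the Laplace integral is finite at \<open>d / 2\<close>.
\<close>
lemma laplace_has_field_derivative:
  assumes "Re z > 0"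
  shows "(laplace has_field_derivative
            (\<integral>t. - (of_real t * exp (- (z * complex_of_real t))) \<partial>\<sigma>)) (at z)"
  unfolding has_field_derivative_iff tendsto_at_iff_sequentially o_def
proof (intro allI impI)
  fix X :: "nat \<Rightarrow> complex"
  assume "\<forall>i. X i \<in> UNIV - {z}" and X: "X \<longlonglongrightarrow> z"
  then have X_neq: "X i \<noteq> z" for i by auto
  define d where "d = Re z / 2"
  have d: "d > 0" using assms by (simp add: d_def)
  define q where
    "q w t = (exp (- (w * complex_of_real t)) - exp (- (z * complex_of_real t))) / (w - z)" for w t
  have "eventually (\<lambda>i. dist (X i) z < d) sequentially"
    using X d by (rule tendstoD)
  then obtain N where N: "\<And>i. i \<ge> N \<Longrightarrow> cmod (X i - z) \<le> d"
    by (auto simp: eventually_sequentially dist_norm intro: less_imp_le)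
  have N_pos: "Re (X (i + N)) > 0" for i
    using N[of "i + N"] abs_Re_le_cmod[of "X (i + N) - z"] assms by (auto simp: d_def)
  have kernel_deriv: "((\<lambda>w. exp (- (w * complex_of_real t))) has_field_derivative
      - (of_real t * exp (- (z * complex_of_real t)))) (at z)" for t
    by (auto intro!: derivative_eq_intros)
  have "(\<lambda>i. integral\<^sup>L \<sigma> (q (X (i + N))))
      \<longlonglongrightarrow> (\<integral>t. - (of_real t * exp (- (z * complex_of_real t))) \<partial>\<sigma>)"
  proof (rule integral_dominated_convergence)
    show "integrable \<sigma> (\<lambda>t. (2 / d) * exp (- (d / 2 * t)))"
      by (intro integrable_mult_right integrable_exp) (use d in simp)
    show "AE t in \<sigma>. (\<lambda>i. q (X (i + N)) t)
        \<longlonglongrightarrow> - (of_real t * exp (- (z * complex_of_real t)))"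
      using kernel_deriv X X_neq
      unfolding has_field_derivative_iff tendsto_at_iff_sequentially o_def q_def
      by (intro AE_I2 LIMSEQ_ignore_initial_segment) auto
    show "AE t in \<sigma>. norm (q (X (i + N)) t) \<le> (2 / d) * exp (- (d / 2 * t))" for i
    proof (rule AE_I2)
      fix t assume "t \<in> space \<sigma>"
      then have t: "t \<ge> 0" by (rule space_nonneg)
      have "norm (q (X (i + N)) t) \<le> t * exp (- ((Re z - d) * t))"
        using complex_exp_difference_bound[OF t N[of "i + N"]] X_neq[of "i + N"]
        by (simp add: q_def norm_divide divide_le_eq)
      also have "\<dots> = (d / 2 * t) * exp (- (d / 2 * t)) * (2 / d) * exp (- (d / 2 * t))"
        using d by (simp add: d_def field_simps flip: exp_add)
      \<comment> \<open>\<open>s exp(-s) \<le> 1\<close> for \<open>s = d t / 2\<close>\<close>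
      also have "\<dots> \<le> 1 * (2 / d) * exp (- (d / 2 * t))"
        using d exp_ge_add_one_self[of "d / 2 * t"]
        by (intro mult_right_mono) (auto simp: exp_minus field_simps)
      finally show "norm (q (X (i + N)) t) \<le> (2 / d) * exp (- (d / 2 * t))"
        by simp
    qed
  qed (unfold q_def, (rule borel_measurable_restrict, measurable)+)
  also have "(\<lambda>i. integral\<^sup>L \<sigma> (q (X (i + N)))) = (\<lambda>i. (laplace (X (i + N)) - laplace z) / (X (i + N) - z))"
    unfolding q_def laplace_def using N_pos assms by (simp add: integrable_kernel)
  finally show "(\<lambda>i. (laplace (X i) - laplace z) / (X i - z))
      \<longlonglongrightarrow> (\<integral>t. - (of_real t * exp (- (z * complex_of_real t))) \<partial>\<sigma>)"
    by (rule LIMSEQ_offset)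
qed

lemma laplace_holomorphic: "laplace holomorphic_on right_half_plane"
  unfolding holomorphic_on_def field_differentiable_def right_half_plane_def
  using laplace_has_field_derivative by (blast intro: has_field_derivative_at_within)

end

section \<open>Integrals over the half-line\<close>

text \<open>
  Change of variables on compact intervals that exhaust the open half-line, followed by monotone
  convergence. Staying away from the origin keeps \<open>u powr p\<close> continuously differentiable for
  every \<open>p > 0\<close>.
\<close>
lemma nn_integral_powr_substitution_le:
  fixes h :: "real \<Rightarrow> real"
  assumes p: "p > 0" and [measurable]: "h \<in> borel_measurable borel"
  shows "(\<integral>\<^sup>+y\<in>{0<..}. ennreal (h y) \<partial>lborel)
       \<le> (\<integral>\<^sup>+u\<in>{0<..}. ennreal (h (u powr p) * (p * u powr (p - 1))) \<partial>lborel)"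
    (is "?lhs \<le> ?rhs")
proof -
  define a b where "a n = inverse (real (Suc n))" and "b n = real (Suc n)" for n
  have a_pos: "a n > 0" and ab: "a n \<le> b n" for n
    by (simp_all add: a_def b_def field_simps)
  define J where "J n = {a n powr p .. b n powr p}" for n
  have J_sets [measurable]: "J n \<in> sets borel" for n
    by (simp add: J_def)
  have J_pos: "J n \<subseteq> {0<..}" for n
    using a_pos[of n] by (force simp: J_def intro: less_le_trans[of 0 "a n powr p"])
  have a_anti: "a n \<le> a m" and b_mono: "b m \<le> b n" if "m \<le> n" for m n
    using that by (simp_all add: a_def b_def field_simps)
  have J_mono: "J m \<subseteq> J n" if "m \<le> n" for m n
    unfolding J_def using a_anti[OF that] b_mono[OF that] a_pos[of m] a_pos[of n] ab[of m] p
    by (simp add: powr_mono2)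
  have J_exhausts: "\<exists>n. y \<in> J n" if "y > 0" for y
  proof -
    \<comment> \<open>An index works as soon as it exceeds both \<open>u\<close> and \<open>1/u\<close>.\<close>
    define u where "u = y powr (1 / p)"
    have u: "u > 0" "u powr p = y"
      using that p by (simp_all add: u_def powr_powr)
    obtain n where n: "real n \<ge> max u (inverse u)"
      using real_arch_simple by blast
    then have "inverse u \<le> real (Suc n)" and "u \<le> b n"
      by (simp_all add: b_def)
    moreover from this(1) have "a n \<le> inverse (inverse u)"
      unfolding a_def using u by (intro le_imp_inverse_le) auto
    ultimately have "y \<in> J n"
      unfolding J_def u(2)[symmetric] using u a_pos[of n] p by (auto intro!: powr_mono2)
    then show ?thesis ..
  qed
  have J_union: "(SUP n. ennreal (h y) * indicator (J n) y) = ennreal (h y) * indicator {0<..} y"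
    for y
  proof (rule antisym)
    show "(SUP n. ennreal (h y) * indicator (J n) y) \<le> ennreal (h y) * indicator {0<..} y"
      using J_pos by (intro SUP_least) (auto split: split_indicator)
    show "ennreal (h y) * indicator {0<..} y \<le> (SUP n. ennreal (h y) * indicator (J n) y)"
    proof (cases "y > 0")
      case True
      then obtain n where "y \<in> J n" using J_exhausts by blast
      then show ?thesis using True by (intro SUP_upper2[of n]) auto
    qed simp
  qed
  have "?lhs = (\<integral>\<^sup>+y. (SUP n. ennreal (h y) * indicator (J n) y) \<partial>lborel)"
    by (simp add: J_union)
  also have "\<dots> = (SUP n. \<integral>\<^sup>+y. ennreal (h y) * indicator (J n) y \<partial>lborel)"
  proof (rule nn_integral_monotone_convergence_SUP)
    show "incseq (\<lambda>n y. ennreal (h y) * indicator (J n) y)"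
      using J_mono by (fastforce intro!: monoI le_funI split: split_indicator)
  qed measurable
  also have "\<dots> \<le> ?rhs"
  proof (rule SUP_least)
    fix n
    have "(\<integral>\<^sup>+y. ennreal (h y) * indicator (J n) y \<partial>lborel)
        = (\<integral>\<^sup>+y. ennreal (h y * indicator (J n) y) \<partial>lborel)"
      by (intro nn_integral_cong) (auto split: split_indicator)
    also have "\<dots> = (\<integral>\<^sup>+u. ennreal (h (u powr p) * (p * u powr (p - 1))
                          * indicator {a n..b n} u) \<partial>lborel)"
      unfolding J_def
    proof (rule nn_integral_substitution)
      show "set_borel_measurable borel {a n powr p..b n powr p} h"
        unfolding set_borel_measurable_def by measurable
      show "((\<lambda>u. u powr p) has_real_derivative p * x powr (p - 1)) (at x)"
        if "x \<in> {a n..b n}" for x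
        using that a_pos[of n] by (intro has_real_derivative_powr) auto
      show "continuous_on {a n..b n} (\<lambda>x. p * x powr (p - 1))"
        using a_pos[of n] by (intro continuous_intros) auto
    qed (use p ab in auto)
    also have "\<dots> \<le> ?rhs"
      using a_pos[of n] by (intro nn_integral_mono) (auto split: split_indicator)
    finally show "(\<integral>\<^sup>+y. ennreal (h y) * indicator (J n) y \<partial>lborel) \<le> ?rhs" .
  qed
  finally show ?thesis .
qed

lemma nn_integral_inverse_square_plus_one:
  "(\<integral>\<^sup>+u. ennreal (1 / (u\<^sup>2 + 1)) * indicator {0<..} u \<partial>lborel) \<le> ennreal (pi / 2)"
proof -
  have "(\<integral>\<^sup>+u. ennreal (1 / (u\<^sup>2 + 1)) * indicator {0<..} u \<partial>lborel)
      \<le> (\<integral>\<^sup>+u. ennreal (1 / (u\<^sup>2 + 1)) * indicator {0..} u \<partial>lborel)"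
    by (intro nn_integral_mono) (auto split: split_indicator)
  also have "\<dots> = ennreal (pi / 2 - arctan 0)"
    by (rule nn_integral_FTC_atLeast)
       (auto intro!: derivative_eq_intros tendsto_arctan_at_top simp: field_simps)
  finally show ?thesis by simp
qed

text \<open>
  The integrals are compared separately on \<open>c u < 1\<close>, where the weight is at most \<open>1\<close> and rescaling
  costs a factor \<open>1/c\<close>, and on \<open>c u \<ge> 1\<close>, where \<open>g(c u)\<close> is at most \<open>g(1)\<close>, the least value of \<open>g\<close>
  on \<open>(0,1]\<close> and therefore at most its mean there.
\<close>
lemma antimono_weighted_integral_bound:
  fixes g :: "real \<Rightarrow> real"
  assumes c: "c > 0"
    and anti: "\<And>x y. 0 < x \<Longrightarrow> x \<le> y \<Longrightarrow> g y \<le> g x"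
    and nonneg: "\<And>x. x > 0 \<Longrightarrow> 0 \<le> g x"
    and [measurable]: "g \<in> borel_measurable borel"
  shows "(\<integral>\<^sup>+u. ennreal (g (c * u) / (u\<^sup>2 + 1)) * indicator {0<..} u \<partial>lborel)
       \<le> ennreal (1 / c + pi / 2) * (\<integral>\<^sup>+x\<in>{0<..<1}. ennreal (g x) \<partial>lborel)"
proof -
  define A where "A = (\<integral>\<^sup>+x\<in>{0<..<1}. ennreal (g x) \<partial>lborel)"
  have "(\<integral>\<^sup>+x\<in>{0<..<1::real}. ennreal (g 1) \<partial>lborel) \<le> A"
    unfolding A_def
    by (intro nn_integral_mono) (use anti[of _ 1] in \<open>auto intro!: ennreal_leI split: split_indicator\<close>)
  then have g1: "ennreal (g 1) \<le> A"
    by (simp add: nn_integral_cmult_indicator)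
  have scaled: "(\<integral>\<^sup>+u. ennreal (g (c * u)) * indicator {0<..<1} (c * u) \<partial>lborel) = ennreal (1 / c) * A"
  proof -
    have "A = ennreal c * (\<integral>\<^sup>+u. ennreal (g (c * u)) * indicator {0<..<1} (c * u) \<partial>lborel)"
      unfolding A_def using c
        nn_integral_real_affine[of "\<lambda>x. ennreal (g x) * indicator {0<..<1} x" c 0] by simp
    then show ?thesis
      using c by (simp add: mult.assoc[symmetric] ennreal_mult[symmetric])
  qed
  have "(\<integral>\<^sup>+u. ennreal (g (c * u) / (u\<^sup>2 + 1)) * indicator {0<..} u \<partial>lborel)
      \<le> (\<integral>\<^sup>+u. ennreal (g (c * u)) * indicator {0<..<1} (c * u)
             + ennreal (g 1) * (ennreal (1 / (u\<^sup>2 + 1)) * indicator {0<..} u) \<partial>lborel)"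
  proof (rule nn_integral_mono)
    fix u :: real
    consider "u \<le> 0" | "0 < u" "c * u < 1" | "0 < u" "1 \<le> c * u" by linarith
    then show "ennreal (g (c * u) / (u\<^sup>2 + 1)) * indicator {0<..} u
      \<le> ennreal (g (c * u)) * indicator {0<..<1} (c * u)
        + ennreal (g 1) * (ennreal (1 / (u\<^sup>2 + 1)) * indicator {0<..} u)"
    proof cases
      case 2
      then have "g (c * u) / (u\<^sup>2 + 1) \<le> g (c * u)"
        using nonneg[of "c * u"] c by (simp add: divide_le_eq mult_le_cancel_left1 add_pos_nonneg)
      then show ?thesis using 2 c by (auto intro!: add_increasing2 ennreal_leI)
    next
      case 3
      then have "g (c * u) / (u\<^sup>2 + 1) \<le> g 1 * (1 / (u\<^sup>2 + 1))"
        using anti[of 1 "c * u"] by (simp add: divide_right_mono)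
      then show ?thesis using 3 nonneg[of 1] by (auto intro!: ennreal_leI simp flip: ennreal_mult)
    qed simp
  qed
  also have "\<dots> = ennreal (1 / c) * A
      + ennreal (g 1) * (\<integral>\<^sup>+u. ennreal (1 / (u\<^sup>2 + 1)) * indicator {0<..} u \<partial>lborel)"
    by (subst nn_integral_add) (auto simp: scaled nn_integral_cmult)
  also have "\<dots> \<le> ennreal (1 / c) * A + A * ennreal (pi / 2)"
    by (intro add_mono mult_mono g1 nn_integral_inverse_square_plus_one) auto
  also have "\<dots> = ennreal (1 / c + pi / 2) * A"
    using c by (simp add: ennreal_plus distrib_left mult.commute)
  finally show ?thesis unfolding A_def .
qed

lemma nn_integral_even_reflection:
  fixes h :: "real \<Rightarrow> ennreal"
  assumes [measurable]: "(\<lambda>y. h y * indicator {0<..} y) \<in> borel_measurable borel"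
  shows "(\<integral>\<^sup>+y. h \<bar>y\<bar> \<partial>lborel) = 2 * (\<integral>\<^sup>+y\<in>{0<..}. h y \<partial>lborel)"
proof -
  let ?k = "\<lambda>y. h y * indicator {0<..} y"
  have "(\<integral>\<^sup>+y. h \<bar>y\<bar> \<partial>lborel) = (\<integral>\<^sup>+y. ?k y + ?k (0 + -1 * y) \<partial>lborel)"
  proof (rule nn_integral_cong_AE)
    show "AE y in lborel. h \<bar>y\<bar> = ?k y + ?k (0 + -1 * y)"
      using AE_lborel_singleton[of 0] by eventually_elim (auto split: split_indicator)
  qed
  also have "\<dots> = (\<integral>\<^sup>+y. ?k y \<partial>lborel) + (\<integral>\<^sup>+y. ?k (0 + -1 * y) \<partial>lborel)"
    by (rule nn_integral_add) measurable
  also have "(\<integral>\<^sup>+y. ?k (0 + -1 * y) \<partial>lborel) = (\<integral>\<^sup>+y. ?k y \<partial>lborel)"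
    using nn_integral_real_affine[of ?k "-1" 0] by simp
  finally show ?thesis by (simp add: mult_2)
qed

section \<open>Powers on the half-plane and the transform\<close>

definition sector_cos :: "real \<Rightarrow> real" where
  "sector_cos p = cos (pi / (2 * p))"

lemma sector_cos_pos:
  assumes "p > 1"
  shows "sector_cos p > 0"
proof -
  have "pi / (2 * p) < pi / 2" "0 < pi / (2 * p)"
    using assms by (auto simp: field_simps)
  then show ?thesis
    unfolding sector_cos_def by (intro cos_gt_zero_pi) linarith+
qed

text \<open>
  The principal root divides the argument by \<open>p\<close>, so it maps the half-plane into a sector whose
  closure meets the imaginary axis only at the origin. For \<open>p = 1\<close> the
  constant would degenerate to \<open>0\<close>.
\<close>
lemma Re_powr_root_ge:
  assumes p: "p > 1" and z: "Re z > 0"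
  shows "sector_cos p * cmod z powr (1 / p) \<le> Re (z powr of_real (1 / p))"
proof -
  have "z \<noteq> 0" using z by auto
  have "\<bar>Im (Ln z)\<bar> < pi / 2"
    using z Re_Ln_pos_lt[OF \<open>z \<noteq> 0\<close>] by blast
  then have "\<bar>Im (Ln z) / p\<bar> \<le> pi / (2 * p)"
    using p by (simp add: abs_divide field_simps)
  moreover have "pi / (2 * p) \<le> pi"
    using p by (simp add: field_simps)
  ultimately have "sector_cos p \<le> cos \<bar>Im (Ln z) / p\<bar>"
    unfolding sector_cos_def by (intro cos_monotone_0_pi_le) auto
  then have "sector_cos p \<le> cos (Im (Ln z) / p)"
    by (simp only: cos_abs_real)
  moreover have "Re (z powr of_real (1 / p)) = cmod z powr (1 / p) * cos (Im (Ln z) / p)"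
    using \<open>z \<noteq> 0\<close> by (simp add: powr_def Re_exp)
  ultimately show ?thesis
    by (simp add: mult.commute mult_right_mono)
qed

lemma Re_powr_root_pos:
  assumes "p > 1" "Re z > 0"
  shows "Re (z powr of_real (1 / p)) > 0"
proof -
  have "z \<noteq> 0" using assms(2) by auto
  then have "0 < sector_cos p * cmod z powr (1 / p)"
    using sector_cos_pos[OF assms(1)] by simp
  with Re_powr_root_ge[OF assms] show ?thesis by linarith
qed

lemma F_transform_holomorphic:
  assumes p: "p > 1" and f: "f holomorphic_on right_half_plane"
  shows "F_transform p f holomorphic_on right_half_plane"
proof -
  have nonpos: "z \<notin> \<real>\<^sub>\<le>\<^sub>0" if "z \<in> right_half_plane" for z
    using that by (auto simp: right_half_plane_def complex_nonpos_Reals_iff)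
  have root: "(\<lambda>z. z powr of_real (1 / p)) holomorphic_on right_half_plane"
    using nonpos by (intro holomorphic_intros) auto
  have "(f \<circ> (\<lambda>z. z powr of_real (1 / p))) holomorphic_on right_half_plane"
    by (rule holomorphic_on_compose_gen[OF root f])
       (use Re_powr_root_pos[OF p] in \<open>auto simp: right_half_plane_def\<close>)
  moreover have "z powr of_real (1 / p) + 1 \<noteq> 0" if "z \<in> right_half_plane" for z
    using Re_powr_root_pos[OF p, of z] that
    by (auto simp: right_half_plane_def complex_eq_iff)
  ultimately show ?thesis
    unfolding F_transform_def[abs_def] o_def using nonpos
    by (intro holomorphic_intros root) (auto simp: right_half_plane_def)
qed

lemma cnj_F_transform:
  assumes p: "p > 1" and z: "z \<in> right_half_plane"
    and f: "\<And>w. w \<in> right_half_plane \<Longrightarrow> cnj (f w) = f (cnj w)"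
  shows "cnj (F_transform p f z) = F_transform p f (cnj z)"
proof -
  have "Re z > 0" using z by (simp add: right_half_plane_def)
  then have "z powr of_real (1 / p) \<in> right_half_plane"
    using Re_powr_root_pos[OF p] by (simp add: right_half_plane_def)
  moreover have "cnj (z powr of_real a) = cnj z powr of_real a" for a
    using \<open>Re z > 0\<close> by (subst cnj_powr) auto
  ultimately show ?thesis
    unfolding F_transform_def
    by (simp add: f del: of_real_divide of_real_diff of_real_mult)
qed

section \<open>A majorant common to all vertical lines\<close>

text \<open>
  The function \<open>G\<close> of the introduction, with \<open>g\<close> in place of \<open>f\<^sup>2\<close>.
\<close>
definition line_majorant :: "real \<Rightarrow> (real \<Rightarrow> real) \<Rightarrow> real \<Rightarrow> real" where
  "line_majorant p g r =
     g (sector_cos p * r powr (1 / p)) / (r powr ((p - 1) / p) * (r powr (2 / p) + 1))"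

text \<open>
  Every factor is monotone in the modulus of \<open>z\<close>, so the modulus can be replaced by the smaller
  number \<open>|Im z|\<close>; the bound then no longer depends on the abscissa. The real axis is excluded
  because \<open>line_majorant\<close> takes the default value of a division by zero at the origin; this costs
  one point on each vertical line.
\<close>
lemma F_transform_le_line_majorant:
  assumes p: "p > 1" and z: "Re z > 0" "Im z \<noteq> 0"
    and horizontal: "\<And>w. Re w > 0 \<Longrightarrow> (cmod (f w))\<^sup>2 \<le> g (Re w)"
    and anti: "\<And>x y. 0 < x \<Longrightarrow> x \<le> y \<Longrightarrow> g y \<le> g x"
  shows "(cmod (F_transform p f z))\<^sup>2 \<le> line_majorant p g \<bar>Im z\<bar>"
proof -
  define s where "s = \<bar>Im z\<bar>"
  define w where "w = z powr of_real (1 / p)"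
  have "s > 0" "s \<le> cmod z"
    using z abs_Im_le_cmod by (simp_all add: s_def)
  have powr_le: "s powr a \<le> cmod z powr a" if "a \<ge> 0" for a
    using \<open>s > 0\<close> \<open>s \<le> cmod z\<close> that by (intro powr_mono2) auto
  have w_norm: "cmod w = cmod z powr (1 / p)"
    unfolding w_def by (subst norm_powr_real_powr') auto
  have w_sq: "(cmod w)\<^sup>2 = cmod z powr (2 / p)"
    using \<open>s > 0\<close> \<open>s \<le> cmod z\<close> by (simp add: w_norm power2_eq_square flip: powr_add)
  have w_pos: "Re w > 0"
    using Re_powr_root_pos[OF p z(1)] by (simp add: w_def)
  have "sector_cos p * s powr (1 / p) \<le> sector_cos p * cmod z powr (1 / p)"
    using sector_cos_pos[OF p] powr_le[of "1 / p"] p by (intro mult_left_mono) auto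
  also have "\<dots> \<le> Re w"
    unfolding w_def by (rule Re_powr_root_ge[OF p z(1)])
  finally have "g (Re w) \<le> g (sector_cos p * s powr (1 / p))"
    using sector_cos_pos[OF p] \<open>s > 0\<close> by (intro anti) auto
  with horizontal[OF w_pos] have num: "(cmod (f w))\<^sup>2 \<le> g (sector_cos p * s powr (1 / p))"
    by linarith
  have "s powr (2 / p) + 1 \<le> (cmod w)\<^sup>2 + 1"
    using powr_le[of "2 / p"] p by (simp add: w_sq)
  also have "\<dots> \<le> (cmod (w + 1))\<^sup>2"
    using w_pos by (simp only: cmod_power2) (simp add: power2_eq_square algebra_simps)
  finally have den1: "s powr (2 / p) + 1 \<le> (cmod (w + 1))\<^sup>2" .
  have "(cmod (z powr of_real ((p - 1) / (2 * p))))\<^sup>2 = cmod z powr ((p - 1) / p)"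
    using p by (subst norm_powr_real_powr') (auto simp: power2_eq_square simp flip: powr_add)
  then have den2: "s powr ((p - 1) / p) \<le> (cmod (z powr of_real ((p - 1) / (2 * p))))\<^sup>2"
    using powr_le[of "(p - 1) / p"] p by simp
  have "(cmod (F_transform p f z))\<^sup>2
      = (cmod (f w))\<^sup>2 / ((cmod (z powr of_real ((p - 1) / (2 * p))))\<^sup>2 * (cmod (w + 1))\<^sup>2)"
    by (simp add: F_transform_def w_def norm_divide norm_mult power_divide power_mult_distrib)
  also have "\<dots> \<le> line_majorant p g s"
    unfolding line_majorant_def
    by (intro frac_le mult_mono mult_pos_pos order_trans[OF zero_le_power2 num] num den1 den2)
       (use \<open>s > 0\<close> in \<open>auto intro: add_nonneg_pos\<close>)
  finally show ?thesis by (simp add: s_def)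
qed

text \<open>
  The Jacobian cancels the singular factor of the majorant, which is what the exponent
  \<open>(p - 1)/(2p)\<close> in the transform is made for.
\<close>
lemma line_majorant_substitution:
  assumes "p > 0" "u > 0"
  shows "line_majorant p g (u powr p) * (p * u powr (p - 1))
       = p * (g (sector_cos p * u) / (u\<^sup>2 + 1))"
  using assms by (simp add: line_majorant_def powr_powr)

lemma nn_integral_F_transform_le:
  assumes p: "p > 1" and x: "x > 0"
    and horizontal: "\<And>w. Re w > 0 \<Longrightarrow> (cmod (f w))\<^sup>2 \<le> g (Re w)"
    and anti: "\<And>x y. 0 < x \<Longrightarrow> x \<le> y \<Longrightarrow> g y \<le> g x"
    and meas [measurable]: "g \<in> borel_measurable borel"
  shows "(\<integral>\<^sup>+y. ennreal ((cmod (F_transform p f (Complex x y)))\<^sup>2) \<partial>lborel)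
       \<le> ennreal (2 * p * (1 / sector_cos p + pi / 2)) * (\<integral>\<^sup>+x\<in>{0<..<1}. ennreal (g x) \<partial>lborel)"
    (is "?lhs \<le> _ * ?A")
proof -
  have g_nonneg: "g t \<ge> 0" if "t > 0" for t
    using horizontal[of "of_real t"] that by (auto intro: order_trans[OF zero_le_power2])
  have [measurable]: "line_majorant p g \<in> borel_measurable borel"
    unfolding line_majorant_def by measurable
  have "?lhs \<le> (\<integral>\<^sup>+y. ennreal (line_majorant p g \<bar>y\<bar>) \<partial>lborel)"
  proof (rule nn_integral_mono_AE)
    show "AE y in lborel. ennreal ((cmod (F_transform p f (Complex x y)))\<^sup>2)
        \<le> ennreal (line_majorant p g \<bar>y\<bar>)"
      using AE_lborel_singleton[of 0]
    proof eventually_elim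
      case (elim y)
      then show ?case
        using F_transform_le_line_majorant[OF p, of "Complex x y" f g] x horizontal anti
        by (intro ennreal_leI) auto
    qed
  qed
  also have "\<dots> = 2 * (\<integral>\<^sup>+y\<in>{0<..}. ennreal (line_majorant p g y) \<partial>lborel)"
    by (rule nn_integral_even_reflection) measurable
  also have "(\<integral>\<^sup>+y\<in>{0<..}. ennreal (line_majorant p g y) \<partial>lborel)
      \<le> (\<integral>\<^sup>+u\<in>{0<..}. ennreal (line_majorant p g (u powr p) * (p * u powr (p - 1))) \<partial>lborel)"
    using p by (intro nn_integral_powr_substitution_le) auto
  also have "\<dots> = (\<integral>\<^sup>+u. ennreal p *
      (ennreal (g (sector_cos p * u) / (u\<^sup>2 + 1)) * indicator {0<..} u) \<partial>lborel)"
    using p by (intro nn_integral_cong)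
      (auto simp: line_majorant_substitution simp flip: ennreal_mult' split: split_indicator)
  also have "\<dots> = ennreal p *
      (\<integral>\<^sup>+u\<in>{0<..}. ennreal (g (sector_cos p * u) / (u\<^sup>2 + 1)) \<partial>lborel)"
    by (rule nn_integral_cmult) measurable
  also have "\<dots> \<le> ennreal p * (ennreal (1 / sector_cos p + pi / 2) * ?A)"
    by (intro mult_left_mono antimono_weighted_integral_bound sector_cos_pos p anti g_nonneg meas)
       auto
  finally have "?lhs \<le> 2 * (ennreal p * (ennreal (1 / sector_cos p + pi / 2) * ?A))"
    by (simp add: mult_left_mono)
  also have "\<dots> = ennreal (2 * p * (1 / sector_cos p + pi / 2)) * ?A"
    using p sector_cos_pos[OF p] by (simp add: ennreal_mult mult.assoc)
  finally show ?thesis .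
qed

section \<open>The norm estimate\<close>

text \<open>
  The factor \<open>1/(2\<pi>)\<close> of the Hardy norm times \<open>2p (1/c + \<pi>/2)\<close>, where the \<open>2\<close> accounts for the two
  halves of a vertical line.
\<close>
definition hardy_constant :: "real \<Rightarrow> real" where
  "hardy_constant p = p / pi * (1 / sector_cos p + pi / 2)"

lemma hardy_constant_pos: "p > 1 \<Longrightarrow> hardy_constant p > 0"
  unfolding hardy_constant_def using sector_cos_pos[of p]
  by (intro mult_pos_pos add_pos_pos divide_pos_pos) auto

text \<open>
  Domination by the values on the real axis and monotonicity there are all that the norm estimate
  takes from the Laplace representation; holomorphy makes the restriction to the axis measurable.
\<close>
lemma hardy_sqnorm_F_transform_le:
  assumes p: "p > 1" and hol: "f holomorphic_on right_half_plane"
    and horizontal: "\<And>z. Re z > 0 \<Longrightarrow> cmod (f z) \<le> cmod (f (of_real (Re z)))"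
    and anti: "\<And>x y. 0 < x \<Longrightarrow> x \<le> y \<Longrightarrow> cmod (f (of_real y)) \<le> cmod (f (of_real x))"
  shows "hardy_sqnorm (F_transform p f) \<le> ennreal (hardy_constant p) * L2_sqnorm f"
proof -
  \<comment> \<open>The values of \<open>f\<close> outside the half-plane are arbitrary; the cut-off makes \<open>g\<close> Borel measurable.\<close>
  define F where "F x = indicator {0<..} x *\<^sub>R f (of_real x)" for x
  define g where "g x = (cmod (F x))\<^sup>2" for x
  have "continuous_on {0<..} (\<lambda>x. f (complex_of_real x))"
    using holomorphic_on_imp_continuous_on[OF hol]
    by (rule continuous_on_compose2) (auto simp: right_half_plane_def intro!: continuous_intros)
  then have "F \<in> borel_measurable borel"
    unfolding F_def by (intro borel_measurable_continuous_on_indicator) auto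
  then have g_meas: "g \<in> borel_measurable borel"
    unfolding g_def by measurable
  have g_horizontal: "(cmod (f w))\<^sup>2 \<le> g (Re w)" if "Re w > 0" for w
    using horizontal[OF that] that by (simp add: g_def F_def power_mono)
  have g_anti: "g y \<le> g x" if "0 < x" "x \<le> y" for x y
    using anti[OF that] that by (simp add: g_def F_def power_mono)
  have g_L2: "(\<integral>\<^sup>+x\<in>{0<..<1}. ennreal (g x) \<partial>lborel) = L2_sqnorm f"
    unfolding L2_sqnorm_def g_def F_def by (intro nn_integral_cong) (auto split: split_indicator)
  show ?thesis
    unfolding hardy_sqnorm_def
  proof (rule SUP_least)
    fix x :: real assume "x \<in> {0<..}"
    then have "ennreal (1 / (2 * pi)) *
        (\<integral>\<^sup>+y. ennreal ((cmod (F_transform p f (Complex x y)))\<^sup>2) \<partial>lborel)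
      \<le> ennreal (1 / (2 * pi)) *
        (ennreal (2 * p * (1 / sector_cos p + pi / 2)) * L2_sqnorm f)"
      using nn_integral_F_transform_le[OF p, of x f g] g_horizontal g_anti g_meas
      by (intro mult_left_mono) (auto simp: g_L2)
    also have "\<dots> = ennreal (hardy_constant p) * L2_sqnorm f"
      using p sector_cos_pos[OF p]
      by (simp add: hardy_constant_def mult.assoc[symmetric] ennreal_mult[symmetric])
    finally show "ennreal (1 / (2 * pi)) *
        (\<integral>\<^sup>+y. ennreal ((cmod (F_transform p f (Complex x y)))\<^sup>2) \<partial>lborel)
      \<le> ennreal (hardy_constant p) * L2_sqnorm f" .
  qed
qed

lemma frak_C2_properties:
  assumes "f \<in> frak_C2"
  shows "f holomorphic_on right_half_plane"
    and "Re z > 0 \<Longrightarrow> cmod (f z) \<le> cmod (f (of_real (Re z)))"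
    and "0 < x \<Longrightarrow> x \<le> y \<Longrightarrow> cmod (f (of_real y)) \<le> cmod (f (of_real x))"
    and "z \<in> right_half_plane \<Longrightarrow> cnj (f z) = f (cnj z)"
    and "L2_sqnorm f < \<infinity>"
proof -
  from assms obtain \<sigma> :: "real measure" where
    \<sigma>: "sets \<sigma> = sets (restrict_space borel {0..})"
      "\<And>x. x > 0 \<Longrightarrow> (\<integral>\<^sup>+t. ennreal (exp (- (x * t))) \<partial>\<sigma>) < \<infinity>"
    and f: "\<forall>z\<in>right_half_plane. f z = (\<integral>t. exp (- (z * complex_of_real t)) \<partial>\<sigma>)"
    and "L2_sqnorm f < \<infinity>"
    unfolding frak_C2_def by blast
  interpret laplace_measure \<sigma>
    by standard (use \<sigma> in auto)
  have eq: "f z = laplace z" if "Re z > 0" for z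
    using f that by (simp add: laplace_def right_half_plane_def)
  show "f holomorphic_on right_half_plane"
    using laplace_holomorphic by (rule holomorphic_transform) (simp add: eq right_half_plane_def)
  show "cmod (f z) \<le> cmod (f (of_real (Re z)))" if "Re z > 0"
    using that norm_laplace_le by (simp add: eq)
  show "cmod (f (of_real y)) \<le> cmod (f (of_real x))" if "0 < x" "x \<le> y"
    using that norm_laplace_antimono by (simp add: eq)
  show "cnj (f z) = f (cnj z)" if "z \<in> right_half_plane"
    using that cnj_laplace by (simp add: eq right_half_plane_def)
  show "L2_sqnorm f < \<infinity>" by fact
qed

theorem theorem5p1:
  fixes p :: real
  assumes "p > 1"
  shows "frak_C2 \<subseteq> frak_H p \<and>
    (\<exists>C>0. \<forall>f\<in>frak_C2. frak_H_norm p f \<le> C * L2_norm f)"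
proof -
  have bound: "hardy_sqnorm (F_transform p f) \<le> ennreal (hardy_constant p) * L2_sqnorm f"
    if "f \<in> frak_C2" for f
    using hardy_sqnorm_F_transform_le[OF assms] frak_C2_properties[OF that] by blast
  have finite: "ennreal (hardy_constant p) * L2_sqnorm f < \<infinity>" if "f \<in> frak_C2" for f
    using frak_C2_properties(5)[OF that] by (simp add: ennreal_mult_less_top)
  have "f \<in> frak_H p" if "f \<in> frak_C2" for f
    using F_transform_holomorphic[OF assms] cnj_F_transform[OF assms] frak_C2_properties(1,4)[OF that]
      le_less_trans[OF bound[OF that] finite[OF that]]
    unfolding frak_H_def real_hardy_space_def hardy_space_def by blast
  moreover have "frak_H_norm p f \<le> sqrt (hardy_constant p) * L2_norm f" if "f \<in> frak_C2" for f
  proof -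
    have "enn2real (hardy_sqnorm (F_transform p f)) \<le> hardy_constant p * enn2real (L2_sqnorm f)"
      using enn2real_mono[OF bound[OF that]] finite[OF that] hardy_constant_pos[OF assms]
      by (simp add: enn2real_mult)
    then show ?thesis
      unfolding frak_H_norm_def hardy_norm_def L2_norm_def
      by (simp flip: real_sqrt_mult)
  qed
  moreover have "sqrt (hardy_constant p) > 0"
    using hardy_constant_pos[OF assms] by simp
  ultimately show ?thesis by blast
qed

end
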